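(* Let $n\ge 1$, let $K$ be a finite simplicial complex, let $\mathcal{K}=\{K^u\}_{u\in\mathbb{R}^n}$ be a tame and one-critical $n$-parameter filtration of $K$, and let $\mathcal{V}$ be a discrete gradient vector field on $K$ consistent with $\mathcal{K}$. Let $C\subset\mathbb{R}^n$ be the set of entrance values of the critical simplices of $\mathcal{V}$ and $\overline{C}$ its closure under least upper bound. Fix a field $\mathbb{K}$ and an integer $i$, and let $\mathbb{V}_i=H_i(\mathcal{K})$ be the persistence module $u\mapsto H_i(K^u;\mathbb{K})$. Then for all $u\preceq v$ in $\mathbb{R}^n$: if $\{u'\in\overline{C}\mid u'\preceq u\}$ is non-empty, then $$\rho_{\mathbb{V}_i}(u,v)=\rho_{\mathbb{V}_i}(\overline{u},\overline{v}),\qquad \overline{u}=\max\{u'\in\overline{C}\mid u'\preceq u\},\quad \overline{v}=\max\{v'\in\overline{C}\mid v'\preceq v\};$$ otherwise $\rho_{\mathbb{V}_i}(u,v)=0$.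
   Context: Order: for $u,v\in\mathbb{R}^n$, $u\preceq v$ means $u_j\le v_j$ for all $j$. Least upper bounds in $\mathbb{R}^n$ are coordinatewise maxima. A finite simplicial complex $K$ is a finite collection of non-empty finite sets (simplices) closed under taking non-empty subsets; $\alpha$ is a facet of $\beta$ (and $\beta$ a cofacet of $\alpha$) if $\alpha\subset\beta$ has codimension one. An $n$-parameter filtration of $K$ is a family of subcomplexes $\{K^u\}_{u\in\mathbb{R}^n}$ with $K^u\subseteq K^v$ whenever $u\preceq v$ and $K=\bigcup_u K^u$. It is tame and one-critical if every simplex $\sigma\in K$ has a (unique) entrance value $e(\sigma)\in\mathbb{R}^n$, such that $\sigma\in K^v$ if and only if $e(\sigma)\preceq v$. A discrete vector field $\mathcal{V}$ on $K$ is a set of pairs $(\alpha,\beta)$ of simplices with $\alpha$ a facet of $\beta$, each simplex being in at most one pair. A $V$-path is a sequence $\alpha_0,\beta_0,\alpha_1,\beta_1,\dots,\beta_r,\alpha_{r+1}$ with $(\alpha_i,\beta_i)\in\mathcal{V}$ and $\alpha_{i+1}\neq\alpha_i$ a facet of $\beta_i$ for $i=0,\dots,r$; it is a non-trivial closed path if $r>0$ and $\alpha_0=\alpha_{r+1}$. $\mathcal{V}$ is a (discrete) gradient vector field if it has no non-trivial closed $V$-path. A simplex is critical if it is in no pair of $\mathcal{V}$. $\mathcal{V}$ is consistent with $\mathcal{K}$ if for all $(\sigma,\tau)\in\mathcal{V}$ and all $u$, $\sigma\in K^u\iff\tau\in K^u$. $\overline{C}$ is the set of all least upper bounds of non-empty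 finite subsets of $C$; it is finite, and whenever $\{u'\in\overline{C}\mid u'\preceq u\}$ is non-empty it has a unique maximum. For $u\preceq v$, $\rho_{\mathbb{V}_i}(u,v)$ is the rank of the linear map $H_i(K^u;\mathbb{K})\to H_i(K^v;\mathbb{K})$ induced by inclusion. *)

theory Defs
  imports "HOL-Analysis.Analysis" "HOL-Algebra.AbelCoset"
    "Jordan_Normal_Form.VS_Connect"
begin

section \<open>Simplicial complexes\<close>

definition finite_simplicial_complex :: "'a set set \<Rightarrow> bool" where
  "finite_simplicial_complex K \<longleftrightarrow>
     finite K \<and> (\<forall>\<sigma>\<in>K. finite \<sigma> \<and> \<sigma> \<noteq> {} \<and> (\<forall>\<tau>. \<tau> \<subseteq> \<sigma> \<and> \<tau> \<noteq> {} \<longrightarrow> \<tau> \<in> K))"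

definition subcomplex :: "'a set set \<Rightarrow> 'a set set \<Rightarrow> bool" where
  "subcomplex L K \<longleftrightarrow> finite_simplicial_complex L \<and> L \<subseteq> K"

definition facet :: "'a set \<Rightarrow> 'a set \<Rightarrow> bool" where
  "facet \<alpha> \<beta> \<longleftrightarrow> \<alpha> \<subset> \<beta> \<and> card \<beta> = card \<alpha> + 1"


section \<open>Simplicial homology with coefficients in a field\<close>

text \<open>Simplices are oriented by one total order of the vertex type, fixed once and for all, so
  that inclusions of complexes preserve orientations.\<close>

definition vertex_order :: "'a rel" where
  "vertex_order = (SOME r. linear_order r)"

lemma linear_order_vertex_order: "linear_order vertex_order"
proof -
  obtain r :: "'a rel" where "well_order r"
    using well_order_on by blast
  then have "linear_order r"
    by (simp add: well_order_on_def)
  then show ?thesis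
    unfolding vertex_order_def by (rule someI)
qed

text \<open>For \<open>\<tau> = [v\<^sub>0, \<dots>, v\<^sub>k]\<close> with increasing vertices and \<open>\<sigma> = \<tau> - {v\<^sub>j}\<close>, the
  incidence number is \<open>(-1)\<^sup>j\<close>.\<close>

definition incidence :: "'a set \<Rightarrow> 'a set \<Rightarrow> 'k::field" where
  "incidence \<sigma> \<tau> =
     (if facet \<sigma> \<tau>
      then (- 1) ^ card {w \<in> \<tau>. (w, the_elem (\<tau> - \<sigma>)) \<in> vertex_order - Id}
      else 0)"

text \<open>A chain is represented by its coefficient function. The degree is an integer; in negative
  degrees there are no simplices, hence no nonzero chains. The multiplicative fields of the
  module records below play no role.\<close>

definition chain_space :: "'a set set \<Rightarrow> int \<Rightarrow> ('k::field, 'a set \<Rightarrow> 'k) module" where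
  "chain_space K i =
     \<lparr>carrier = {c. \<forall>\<sigma>. c \<sigma> \<noteq> 0 \<longrightarrow> \<sigma> \<in> K \<and> int (card \<sigma>) = i + 1},
      mult = undefined, one = undefined,
      zero = (\<lambda>\<sigma>. 0), add = (\<lambda>c d \<sigma>. c \<sigma> + d \<sigma>), smult = (\<lambda>a c \<sigma>. a * c \<sigma>)\<rparr>"

definition boundary :: "'a set set \<Rightarrow> ('a set \<Rightarrow> 'k::field) \<Rightarrow> ('a set \<Rightarrow> 'k)" where
  "boundary K c = (\<lambda>\<sigma>. if \<sigma> \<in> K then \<Sum>\<tau>\<in>K. incidence \<sigma> \<tau> * c \<tau> else 0)"

definition cycle_space :: "'a set set \<Rightarrow> int \<Rightarrow> ('k::field, 'a set \<Rightarrow> 'k) module" where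
  "cycle_space K i =
     (chain_space K i)
       \<lparr>carrier := {c \<in> carrier (chain_space K i). boundary K c = \<zero>\<^bsub>chain_space K (i - 1)\<^esub>}\<rparr>"

definition boundaries :: "'a set set \<Rightarrow> int \<Rightarrow> ('a set \<Rightarrow> 'k::field) set" where
  "boundaries K i = boundary K ` carrier (chain_space K (i + 1))"

text \<open>The scalar multiple of a coset \<open>X = N + x\<close> is the coset of \<open>a x\<close>, for any \<open>x \<in> X\<close>; the
  union only avoids choosing a representative.\<close>

definition quotient_space :: "('k, 'c) module \<Rightarrow> 'c set \<Rightarrow> ('k, 'c set) module" where
  "quotient_space M N =
     \<lparr>carrier = a_rcosets\<^bsub>M\<^esub> N, mult = undefined, one = undefined,
      zero = N, add = set_add M, smult = (\<lambda>a X. \<Union>x\<in>X. N +>\<^bsub>M\<^esub> (a \<odot>\<^bsub>M\<^esub> x))\<rparr>"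

definition homology :: "'a set set \<Rightarrow> int \<Rightarrow> ('k::field, ('a set \<Rightarrow> 'k) set) module" where
  "homology K i = quotient_space (cycle_space K i) (boundaries K i)"

text \<open>The map induced by an inclusion \<open>K \<subseteq> L\<close>: the class of a cycle \<open>z\<close> in \<open>K\<close> goes to the class
  of \<open>z\<close> in \<open>L\<close>.\<close>

definition homology_map ::
    "'a set set \<Rightarrow> 'a set set \<Rightarrow> int \<Rightarrow> ('a set \<Rightarrow> 'k::field) set \<Rightarrow> ('a set \<Rightarrow> 'k) set" where
  "homology_map K L i X = (\<Union>z\<in>X. boundaries L i +>\<^bsub>cycle_space L i\<^esub> z)"

definition map_rank ::
    "('k::field, 'b) module \<Rightarrow> ('k, 'c) module \<Rightarrow> ('b \<Rightarrow> 'c) \<Rightarrow> nat" where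
  "map_rank V W f = vectorspace.dim class_ring (W\<lparr>carrier := f ` carrier V\<rparr>)"


section \<open>Filtrations\<close>

text \<open>The order on \<open>real ^ 'n\<close> is the componentwise one.\<close>

definition filtration :: "'a set set \<Rightarrow> (real ^ 'n::finite \<Rightarrow> 'a set set) \<Rightarrow> bool" where
  "filtration K F \<longleftrightarrow>
     (\<forall>u. subcomplex (F u) K) \<and> (\<forall>u v. u \<le> v \<longrightarrow> F u \<subseteq> F v) \<and> K = (\<Union>u. F u)"

definition is_entrance_value ::
    "(real ^ 'n::finite \<Rightarrow> 'a set set) \<Rightarrow> 'a set \<Rightarrow> real ^ 'n \<Rightarrow> bool" where
  "is_entrance_value F \<sigma> e \<longleftrightarrow> (\<forall>v. \<sigma> \<in> F v \<longleftrightarrow> e \<le> v)"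

definition tame_one_critical :: "'a set set \<Rightarrow> (real ^ 'n::finite \<Rightarrow> 'a set set) \<Rightarrow> bool" where
  "tame_one_critical K F \<longleftrightarrow> (\<forall>\<sigma>\<in>K. \<exists>!e. is_entrance_value F \<sigma> e)"

definition entrance_value :: "(real ^ 'n::finite \<Rightarrow> 'a set set) \<Rightarrow> 'a set \<Rightarrow> real ^ 'n" where
  "entrance_value F \<sigma> = (THE e. is_entrance_value F \<sigma> e)"

definition rank_invariant ::
    "'k::field itself \<Rightarrow> (real ^ 'n::finite \<Rightarrow> 'a set set) \<Rightarrow> int \<Rightarrow> real ^ 'n \<Rightarrow> real ^ 'n \<Rightarrow> nat" where
  "rank_invariant _ F i u v =
     map_rank (homology (F u) i :: ('k, ('a set \<Rightarrow> 'k) set) module) (homology (F v) i)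
       (homology_map (F u) (F v) i)"


section \<open>Discrete vector fields\<close>

definition discrete_vector_field :: "'a set set \<Rightarrow> ('a set \<times> 'a set) set \<Rightarrow> bool" where
  "discrete_vector_field K V \<longleftrightarrow>
     (\<forall>(\<alpha>, \<beta>)\<in>V. \<alpha> \<in> K \<and> \<beta> \<in> K \<and> facet \<alpha> \<beta>) \<and>
     (\<forall>\<sigma>\<in>K. \<forall>p\<in>V. \<forall>q\<in>V. \<sigma> \<in> {fst p, snd p} \<and> \<sigma> \<in> {fst q, snd q} \<longrightarrow> p = q)"

text \<open>The path \<open>\<alpha>\<^sub>0, \<beta>\<^sub>0, \<dots>, \<beta>\<^sub>r, \<alpha>\<^sub>r\<^sub>+\<^sub>1\<close>; only the values \<open>\<alpha> 0, \<dots>, \<alpha> (r + 1)\<close> and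
  \<open>\<beta> 0, \<dots>, \<beta> r\<close> matter.\<close>

definition V_path ::
    "'a set set \<Rightarrow> ('a set \<times> 'a set) set \<Rightarrow> nat \<Rightarrow> (nat \<Rightarrow> 'a set) \<Rightarrow> (nat \<Rightarrow> 'a set) \<Rightarrow> bool" where
  "V_path K V r \<alpha> \<beta> \<longleftrightarrow>
     (\<forall>i\<le>r. (\<alpha> i, \<beta> i) \<in> V \<and> \<alpha> (i + 1) \<in> K \<and> \<alpha> (i + 1) \<noteq> \<alpha> i \<and> facet (\<alpha> (i + 1)) (\<beta> i))"

definition gradient_vector_field :: "'a set set \<Rightarrow> ('a set \<times> 'a set) set \<Rightarrow> bool" where
  "gradient_vector_field K V \<longleftrightarrow>
     discrete_vector_field K V \<and>
     \<not> (\<exists>r \<alpha> \<beta>. V_path K V r \<alpha> \<beta> \<and> r > 0 \<and> \<alpha> 0 = \<alpha> (r + 1))"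

definition critical_simplices :: "'a set set \<Rightarrow> ('a set \<times> 'a set) set \<Rightarrow> 'a set set" where
  "critical_simplices K V = {\<sigma> \<in> K. \<forall>(\<alpha>, \<beta>)\<in>V. \<sigma> \<noteq> \<alpha> \<and> \<sigma> \<noteq> \<beta>}"

definition consistent ::
    "('a set \<times> 'a set) set \<Rightarrow> (real ^ 'n::finite \<Rightarrow> 'a set set) \<Rightarrow> bool" where
  "consistent V F \<longleftrightarrow> (\<forall>(\<sigma>, \<tau>)\<in>V. \<forall>u. \<sigma> \<in> F u \<longleftrightarrow> \<tau> \<in> F u)"


section \<open>Closure under least upper bounds\<close>

definition lub_closure :: "(real ^ 'n::finite) set \<Rightarrow> (real ^ 'n) set" where
  "lub_closure C = {\<Squnion>\<^sub>f\<^sub>i\<^sub>nA | A. finite A \<and> A \<noteq> {} \<and> A \<subseteq> C}"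

definition max_below :: "(real ^ 'n::finite) set \<Rightarrow> real ^ 'n \<Rightarrow> real ^ 'n" where
  "max_below D u = (GREATEST u'. u' \<in> D \<and> u' \<le> u)"

lemma max_below_lub_closure:
  assumes fin: "finite C" and ne: "{u' \<in> lub_closure C. u' \<le> u} \<noteq> {}"
  shows "max_below (lub_closure C) u \<in> lub_closure C"
    and "max_below (lub_closure C) u \<le> u"
    and "\<And>u'. u' \<in> lub_closure C \<Longrightarrow> u' \<le> u \<Longrightarrow> u' \<le> max_below (lub_closure C) u"
proof -
  define A where "A = {c \<in> C. c \<le> u}"
  have finA: "finite A" using fin by (simp add: A_def)
  have sub: "B \<subseteq> A" if "finite B" "B \<noteq> {}" "B \<subseteq> C" "\<Squnion>\<^sub>f\<^sub>i\<^sub>nB \<le> u" for B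
    using that Sup_fin.boundedE[of B u] by (auto simp: A_def)
  from ne obtain B where "finite B" "B \<noteq> {}" "B \<subseteq> C" "\<Squnion>\<^sub>f\<^sub>i\<^sub>nB \<le> u"
    by (auto simp: lub_closure_def)
  with sub have neA: "A \<noteq> {}" by blast
  have in_cl: "\<Squnion>\<^sub>f\<^sub>i\<^sub>nA \<in> lub_closure C"
    using finA neA by (auto simp: lub_closure_def A_def)
  have le: "\<Squnion>\<^sub>f\<^sub>i\<^sub>nA \<le> u"
    by (rule Sup_fin.boundedI) (use finA neA in \<open>auto simp: A_def\<close>)
  have greatest: "u' \<le> \<Squnion>\<^sub>f\<^sub>i\<^sub>nA" if u': "u' \<in> lub_closure C" "u' \<le> u" for u'
  proof -
    from u'(1) obtain B where B: "finite B" "B \<noteq> {}" "B \<subseteq> C" "u' = \<Squnion>\<^sub>f\<^sub>i\<^sub>nB"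
      by (auto simp: lub_closure_def)
    then have "B \<subseteq> A" using sub u'(2) by blast
    then show ?thesis using B finA by (simp add: Sup_fin.subset_imp)
  qed
  have "max_below (lub_closure C) u = \<Squnion>\<^sub>f\<^sub>i\<^sub>nA"
    unfolding max_below_def
    by (rule Greatest_equality) (use in_cl le greatest in auto)
  then show "max_below (lub_closure C) u \<in> lub_closure C"
    and "max_below (lub_closure C) u \<le> u"
    and "\<And>u'. u' \<in> lub_closure C \<Longrightarrow> u' \<le> u \<Longrightarrow> u' \<le> max_below (lub_closure C) u"
    using in_cl le greatest by simp_all
qed

end

theory Submission
  imports Defs
begin

text \<open>Let \<open>\<mu>(w)\<close> be the maximum of the lub-closure below \<open>w\<close>. A critical simplex that has entered by
  time \<open>w\<close> has entered by time \<open>\<mu>(w)\<close>, so by consistency \<open>F w - F (\<mu>(w))\<close> is a union of gradient pairs,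
  and \<open>F w\<close> collapses onto \<open>F (\<mu>(w))\<close> by removing free pairs one at a time. Each removal changes a
  relative cycle only by a boundary, which gives: every chain whose boundary lies in the smaller
  complex is, up to a boundary, a chain of the smaller complex. Hence \<open>F (\<mu>(w)) \<subseteq> F w\<close> is an isomorphism on
  homology. If nothing of the lub-closure lies below \<open>u\<close>, then \<open>F u\<close> has no critical simplices and the
  same argument collapses it onto the empty complex.\<close>

section \<open>The simplicial chain complex\<close>

lemma complex_face:
  "finite_simplicial_complex K \<Longrightarrow> \<tau> \<in> K \<Longrightarrow> \<sigma> \<subseteq> \<tau> \<Longrightarrow> \<sigma> \<noteq> {} \<Longrightarrow> \<sigma> \<in> K"
  unfolding finite_simplicial_complex_def by blast

lemma complex_simplex:
  "finite_simplicial_complex K \<Longrightarrow> \<sigma> \<in> K \<Longrightarrow> finite \<sigma> \<and> \<sigma> \<noteq> {}"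
  unfolding finite_simplicial_complex_def by blast

lemma complex_finite: "finite_simplicial_complex K \<Longrightarrow> finite K"
  unfolding finite_simplicial_complex_def by blast

lemma facet_iff_insert:
  assumes "finite \<tau>"
  shows "facet \<sigma> \<tau> \<longleftrightarrow> (\<exists>a. a \<notin> \<sigma> \<and> \<tau> = insert a \<sigma>)"
proof
  assume f: "facet \<sigma> \<tau>"
  then have fin: "finite \<sigma>" and sub: "\<sigma> \<subseteq> \<tau>" using assms finite_subset
    by (auto simp: facet_def)
  have "card (\<tau> - \<sigma>) = 1"
    using f by (simp add: card_Diff_subset[OF fin sub] facet_def)
  then obtain a where "\<tau> - \<sigma> = {a}" by (auto simp: card_1_singleton_iff)
  with sub have "a \<notin> \<sigma> \<and> \<tau> = insert a \<sigma>" by auto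
  then show "\<exists>a. a \<notin> \<sigma> \<and> \<tau> = insert a \<sigma>" ..
next
  assume "\<exists>a. a \<notin> \<sigma> \<and> \<tau> = insert a \<sigma>"
  with assms show "facet \<sigma> \<tau>" by (auto simp: facet_def)
qed

lemma facetE:
  assumes "facet \<sigma> \<tau>" "finite \<tau>"
  obtains a where "a \<notin> \<sigma>" "\<tau> = insert a \<sigma>"
  using assms facet_iff_insert by blast

lemma incidence_insert:
  assumes "finite \<sigma>" "a \<notin> \<sigma>"
  shows "incidence \<sigma> (insert a \<sigma>) = (- 1) ^ card {w \<in> \<sigma>. (w, a) \<in> vertex_order - Id}"
proof -
  have "facet \<sigma> (insert a \<sigma>)" using assms by (subst facet_iff_insert) auto
  moreover have "insert a \<sigma> - \<sigma> = {a}" using assms by auto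
  moreover have "{w \<in> insert a \<sigma>. (w, a) \<in> vertex_order - Id}
      = {w \<in> \<sigma>. (w, a) \<in> vertex_order - Id}" by auto
  ultimately show ?thesis by (simp add: incidence_def)
qed

lemma incidence_nonzero:
  assumes "finite \<tau>" "facet \<sigma> \<tau>"
  shows "(incidence \<sigma> \<tau> :: 'k::field) \<noteq> 0"
  using assms by (auto simp: incidence_def)

text \<open>Say \<open>a\<close> precedes \<open>b\<close>. Adding \<open>a\<close> moves
  \<open>b\<close> one position further, while adding \<open>b\<close> leaves the position of
  \<open>a\<close> unchanged; so the two routes from \<open>\<sigma>\<close> to its extension by
  both vertices carry opposite signs.\<close>

lemma incidence_cancel:
  assumes "finite \<sigma>" "a \<notin> \<sigma>" "b \<notin> \<sigma>" "a \<noteq> b"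
  shows "incidence \<sigma> (insert a \<sigma>) * incidence (insert a \<sigma>) (insert b (insert a \<sigma>)) +
    incidence \<sigma> (insert b \<sigma>) * incidence (insert b \<sigma>) (insert b (insert a \<sigma>)) = (0 :: 'k::field)"
proof -
  define N where "N x = card {w \<in> \<sigma>. (w, x) \<in> vertex_order - Id}" for x :: 'a
  \<comment> \<open>Proved for fresh \<open>a\<close>, \<open>b\<close> in increasing order; since
    the vertex order is total, the lemma is this case or its mirror image.\<close>
  have main: "incidence \<sigma> (insert a \<sigma>) * incidence (insert a \<sigma>) (insert b (insert a \<sigma>)) +
      incidence \<sigma> (insert b \<sigma>) * incidence (insert b \<sigma>) (insert a (insert b \<sigma>)) = (0 :: 'k)"
    if ab: "(a, b) \<in> vertex_order" "a \<notin> \<sigma>" "b \<notin> \<sigma>" "a \<noteq> b" for a b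
  proof -
    have "(b, a) \<notin> vertex_order"
      using linear_order_vertex_order ab
      by (auto simp: linear_order_on_def partial_order_on_def antisym_def)
    then have "{w \<in> insert b \<sigma>. (w, a) \<in> vertex_order - Id} = {w \<in> \<sigma>. (w, a) \<in> vertex_order - Id}"
      by auto
    moreover have "{w \<in> insert a \<sigma>. (w, b) \<in> vertex_order - Id}
        = insert a {w \<in> \<sigma>. (w, b) \<in> vertex_order - Id}"
      using ab by auto
    then have "card {w \<in> insert a \<sigma>. (w, b) \<in> vertex_order - Id} = Suc (N b)"
      using ab assms(1) by (simp add: N_def)
    ultimately show ?thesis
      using ab assms(1) by (simp add: incidence_insert N_def)
  qed
  have "(a, b) \<in> vertex_order \<or> (b, a) \<in> vertex_order"
    using linear_order_vertex_order assms(4)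
    by (auto simp: linear_order_on_def total_on_def)
  then show ?thesis
    using main[of a b] main[of b a] assms by (auto simp: insert_commute add.commute)
qed

text \<open>A nonzero summand needs an intermediate facet. If there is one, \<open>\<tau>\<close>
  exceeds \<open>\<sigma>\<close> by two vertices \<open>a\<close>, \<open>b\<close>; only the two
  simplices adding one of them contribute, and their terms cancel.\<close>

lemma sum_incidence_incidence:
  assumes K: "finite_simplicial_complex K" and \<sigma>: "\<sigma> \<in> K" and \<tau>: "\<tau> \<in> K"
  shows "(\<Sum>\<rho>\<in>K. incidence \<sigma> \<rho> * incidence \<rho> \<tau>) = (0 :: 'k::field)"
proof (cases "\<exists>\<rho>\<in>K. facet \<sigma> \<rho> \<and> facet \<rho> \<tau>")
  case False
  then show ?thesis by (intro sum.neutral) (auto simp: incidence_def)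
next
  case True
  then obtain \<rho> where \<rho>: "\<rho> \<in> K" "facet \<sigma> \<rho>" "facet \<rho> \<tau>" by auto
  have fin: "finite x" if "x \<in> K" for x
    using complex_simplex[OF K that] ..
  obtain a where a: "a \<notin> \<sigma>" "\<rho> = insert a \<sigma>"
    using facetE[OF \<rho>(2) fin[OF \<rho>(1)]] .
  obtain b where b: "b \<notin> \<rho>" "\<tau> = insert b \<rho>"
    using facetE[OF \<rho>(3) fin[OF \<tau>]] .
  have ab: "b \<notin> \<sigma>" "a \<noteq> b" using a b by auto
  have sub: "{insert a \<sigma>, insert b \<sigma>} \<subseteq> K"
    using complex_face[OF K \<tau>] a b by auto
  have "incidence \<sigma> \<rho>' * incidence \<rho>' \<tau> = (0 :: 'k)" if \<rho>': "\<rho>' \<in> K - {insert a \<sigma>, insert b \<sigma>}" for \<rho>'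
  proof (rule ccontr)
    assume "incidence \<sigma> \<rho>' * incidence \<rho>' \<tau> \<noteq> (0 :: 'k)"
    then have f: "facet \<sigma> \<rho>'" "\<rho>' \<subseteq> \<tau>" by (auto simp: incidence_def facet_def split: if_splits)
    then obtain c where "c \<notin> \<sigma>" "\<rho>' = insert c \<sigma>"
      using facetE[OF f(1) fin] \<rho>' by auto
    then show False using \<rho>' \<open>\<rho>' \<subseteq> \<tau>\<close> a b by auto
  qed
  then have "(\<Sum>\<rho>\<in>K. incidence \<sigma> \<rho> * incidence \<rho> \<tau>) =
      (\<Sum>\<rho>\<in>{insert a \<sigma>, insert b \<sigma>}. incidence \<sigma> \<rho> * incidence \<rho> \<tau> :: 'k)"
    using complex_finite[OF K] sub by (intro sum.mono_neutral_right) auto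
  also have "insert a \<sigma> \<noteq> insert b \<sigma>" using a ab by auto
  then have "(\<Sum>\<rho>\<in>{insert a \<sigma>, insert b \<sigma>}. incidence \<sigma> \<rho> * incidence \<rho> \<tau> :: 'k) = 0"
    using incidence_cancel[of \<sigma> a b] a b ab \<sigma> fin by simp
  finally show ?thesis .
qed

section \<open>The boundary operator and its square\<close>

lemma boundary_boundary:
  assumes K: "finite_simplicial_complex K"
  shows "boundary K (boundary K c) = (\<lambda>\<sigma>. 0 :: 'k::field)"
proof
  fix \<sigma> :: "'a set"
  show "boundary K (boundary K c) \<sigma> = 0"
  proof (cases "\<sigma> \<in> K")
    case True
    have "boundary K (boundary K c) \<sigma> =
        (\<Sum>\<rho>\<in>K. \<Sum>\<tau>\<in>K. c \<tau> * (incidence \<sigma> \<rho> * incidence \<rho> \<tau>))"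
      using True by (simp add: boundary_def sum_distrib_left ac_simps)
    also have "\<dots> = (\<Sum>\<tau>\<in>K. c \<tau> * (\<Sum>\<rho>\<in>K. incidence \<sigma> \<rho> * incidence \<rho> \<tau>))"
      by (subst sum.swap) (simp add: sum_distrib_left)
    also have "\<dots> = 0" using sum_incidence_incidence[OF K True, where 'k = 'k]
      by (intro sum.neutral) simp
    finally show ?thesis .
  qed (simp add: boundary_def)
qed

lemma boundary_zero: "boundary K (\<lambda>\<sigma>. 0) = (\<lambda>\<sigma>. 0)"
  by (auto simp: boundary_def)

lemma boundary_add: "boundary K (\<lambda>\<sigma>. c \<sigma> + d \<sigma>) = (\<lambda>\<sigma>. boundary K c \<sigma> + boundary K d \<sigma>)"
  by (auto simp: boundary_def sum.distrib algebra_simps)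

lemma boundary_scale: "boundary K (\<lambda>\<sigma>. a * c \<sigma>) = (\<lambda>\<sigma>. a * boundary K c \<sigma>)"
  by (auto simp: boundary_def sum_distrib_left ac_simps)

lemma boundary_diff: "boundary K (\<lambda>\<sigma>. c \<sigma> - d \<sigma>) = (\<lambda>\<sigma>. boundary K c \<sigma> - boundary K d \<sigma>)"
  by (auto simp: boundary_def sum_subtractf algebra_simps)

section \<open>Chains, cycles and boundaries under inclusion of complexes\<close>

lemma chain_iff:
  "c \<in> carrier (chain_space K i) \<longleftrightarrow> (\<forall>\<sigma>. c \<sigma> \<noteq> 0 \<longrightarrow> \<sigma> \<in> K \<and> int (card \<sigma>) = i + 1)"
  by (simp add: chain_space_def)

lemma boundary_chain:
  assumes "c \<in> carrier (chain_space K i)"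
  shows "boundary K c \<in> carrier (chain_space K (i - 1))"
  unfolding chain_iff
proof (intro allI impI)
  fix \<sigma> assume nz: "boundary K c \<sigma> \<noteq> 0"
  then have "(\<Sum>\<tau>\<in>K. incidence \<sigma> \<tau> * c \<tau>) \<noteq> 0" "\<sigma> \<in> K"
    by (auto simp: boundary_def split: if_splits)
  then obtain \<tau> where "incidence \<sigma> \<tau> * c \<tau> \<noteq> 0"
    by (blast intro: sum.neutral)
  then have "incidence \<sigma> \<tau> \<noteq> (0 :: 'b)" "c \<tau> \<noteq> 0" by auto
  with assms have "facet \<sigma> \<tau>" "int (card \<tau>) = i + 1"
    by (auto simp: incidence_def chain_iff split: if_splits)
  then show "\<sigma> \<in> K \<and> int (card \<sigma>) = i - 1 + 1"
    using \<open>\<sigma> \<in> K\<close> by (simp add: facet_def)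
qed

text \<open>\<open>L\<close> is closed under faces, so a simplex of \<open>K\<close> outside
  \<open>L\<close> is never a facet of one in \<open>L\<close>. This lets a chain keep its boundary
  as a function when the complex grows.\<close>

lemma boundary_subcomplex:
  assumes L: "finite_simplicial_complex L" and K: "finite_simplicial_complex K" and sub: "L \<subseteq> K"
    and c: "\<And>\<sigma>. \<sigma> \<notin> L \<Longrightarrow> c \<sigma> = 0"
  shows "boundary K c = boundary L c"
proof
  fix \<sigma>
  have sum: "(\<Sum>\<tau>\<in>K. incidence \<sigma> \<tau> * c \<tau>) = (\<Sum>\<tau>\<in>L. incidence \<sigma> \<tau> * c \<tau>)"
    using complex_finite[OF K] sub c by (intro sum.mono_neutral_right) auto
  have "(\<Sum>\<tau>\<in>L. incidence \<sigma> \<tau> * c \<tau>) = 0" if "\<sigma> \<in> K" "\<sigma> \<notin> L"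
  proof (rule sum.neutral, rule ballI)
    fix \<tau> assume "\<tau> \<in> L"
    then have "\<not> facet \<sigma> \<tau>"
      using complex_face[OF L] complex_simplex[OF K] that by (auto simp: facet_def)
    then show "incidence \<sigma> \<tau> * c \<tau> = 0" by (simp add: incidence_def)
  qed
  then show "boundary K c \<sigma> = boundary L c \<sigma>"
    using sum sub by (auto simp: boundary_def)
qed

lemma chain_mono: "L \<subseteq> K \<Longrightarrow> carrier (chain_space L i) \<subseteq> carrier (chain_space K i)"
  by (intro subsetI, unfold chain_iff) blast

lemma chain_zero: "(\<lambda>\<sigma>. 0) \<in> carrier (chain_space K i)"
  by (simp add: chain_iff)

lemma chain_add:
  assumes "c \<in> carrier (chain_space K i)" "d \<in> carrier (chain_space K i)"
  shows "(\<lambda>\<sigma>. c \<sigma> + d \<sigma>) \<in> carrier (chain_space K i)"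
  using assms unfolding chain_iff by (metis add_0)

lemma chain_scale:
  assumes "c \<in> carrier (chain_space K i)"
  shows "(\<lambda>\<sigma>. a * c \<sigma>) \<in> carrier (chain_space K i)"
  using assms unfolding chain_iff by (metis mult_zero_right)

lemma chain_diff:
  assumes "c \<in> carrier (chain_space K i)" "d \<in> carrier (chain_space K i)"
  shows "(\<lambda>\<sigma>. c \<sigma> - d \<sigma>) \<in> carrier (chain_space K i)"
  using assms unfolding chain_iff by (metis diff_self)

lemma cycle_iff:
  "z \<in> carrier (cycle_space K i) \<longleftrightarrow>
     z \<in> carrier (chain_space K i) \<and> boundary K z = (\<lambda>\<sigma>. 0)"
  by (simp add: cycle_space_def chain_space_def)

lemma boundary_chain_mono:
  assumes "finite_simplicial_complex L" "finite_simplicial_complex K" "L \<subseteq> K"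
    and "c \<in> carrier (chain_space L i)"
  shows "boundary K c = boundary L c"
  by (rule boundary_subcomplex) (use assms in \<open>auto simp: chain_iff\<close>)

lemma cycle_mono:
  assumes "finite_simplicial_complex L" "finite_simplicial_complex K" "L \<subseteq> K"
  shows "carrier (cycle_space L i) \<subseteq> carrier (cycle_space K i)"
proof
  fix z assume "z \<in> carrier (cycle_space L i)"
  then have z: "z \<in> carrier (chain_space L i)" "boundary L z = (\<lambda>\<sigma>. 0)"
    by (simp_all add: cycle_iff)
  with boundary_chain_mono[OF assms z(1)] show "z \<in> carrier (cycle_space K i)"
    using chain_mono[OF assms(3)] by (auto simp: cycle_iff)
qed

lemma boundaries_mono:
  assumes "finite_simplicial_complex L" "finite_simplicial_complex K" "L \<subseteq> K"
  shows "boundaries L i \<subseteq> boundaries K i"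
proof
  fix z assume "z \<in> boundaries L i"
  then obtain c where c: "c \<in> carrier (chain_space L (i + 1))" "z = boundary L c"
    by (auto simp: boundaries_def)
  moreover have "boundary L c = boundary K c" using boundary_chain_mono[OF assms c(1)] by simp
  ultimately show "z \<in> boundaries K i"
    using chain_mono[OF assms(3)] unfolding boundaries_def by blast
qed

section \<open>Collapsing along a gradient vector field\<close>

lemma vector_field_facet:
  assumes "gradient_vector_field K V" "(\<alpha>, \<beta>) \<in> V"
  shows "\<alpha> \<in> K" "\<beta> \<in> K" "facet \<alpha> \<beta>"
  using assms by (auto simp: gradient_vector_field_def discrete_vector_field_def)

lemma vector_field_unique:
  assumes V: "gradient_vector_field K V" and p: "p \<in> V" "\<sigma> \<in> {fst p, snd p}"
    and q: "q \<in> V" "\<sigma> \<in> {fst q, snd q}"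
  shows "p = q"
proof -
  have "\<sigma> \<in> K" using vector_field_facet[OF V, of "fst p" "snd p"] p by auto
  moreover have "\<forall>\<sigma>\<in>K. \<forall>p\<in>V. \<forall>q\<in>V. \<sigma> \<in> {fst p, snd p} \<and> \<sigma> \<in> {fst q, snd q} \<longrightarrow> p = q"
    using V by (simp add: gradient_vector_field_def discrete_vector_field_def)
  ultimately show ?thesis using p q by blast
qed

text \<open>A directed cycle of pairs is a closed V-path. For finite \<open>V\<close> acyclicity
  makes the relation well-founded, which supplies minimal pairs.\<close>

lemma acyclic_pairs:
  assumes "gradient_vector_field K V"
  shows "acyclic {(p, q). p \<in> V \<and> q \<in> V \<and> fst q \<noteq> fst p \<and> facet (fst q) (snd p)}"
    (is "acyclic ?R")
proof (rule acyclicI, rule allI, rule notI)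
  fix p assume "(p, p) \<in> ?R\<^sup>+"
  then obtain n where n: "n > 0" "(p, p) \<in> ?R ^^ n" by (auto simp: trancl_power)
  then obtain f where f: "f 0 = p" "f n = p" "\<And>i. i < n \<Longrightarrow> (f i, f (Suc i)) \<in> ?R"
    by (auto simp: relpow_fun_conv)
  \<comment> \<open>A loop of length 1 is excluded by \<open>fst q \<noteq> fst p\<close>. Hence
    \<open>r = n - 1\<close> is positive, as a non-trivial closed path demands.\<close>
  have "n \<noteq> 1" using f(3)[of 0] f(1,2) by auto
  with n(1) have n': "n - 1 > 0" "Suc (n - 1) = n" by auto
  have VK: "fst q \<in> K" if "q \<in> V" for q
    using assms that by (auto simp: gradient_vector_field_def discrete_vector_field_def)
  have "(f i \<in> V \<and> f (Suc i) \<in> V) \<and> fst (f (Suc i)) \<noteq> fst (f i) \<and> facet (fst (f (Suc i))) (snd (f i))"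
    if "i \<le> n - 1" for i
    using f(3)[of i] that n' by auto
  then have "V_path K V (n - 1) (fst \<circ> f) (snd \<circ> f)"
    using VK by (simp add: V_path_def)
  moreover have "(fst \<circ> f) 0 = (fst \<circ> f) (n - 1 + 1)" using f n' by simp
  ultimately show False using assms n'(1) unfolding gradient_vector_field_def by blast
qed

text \<open>Phrased for an arbitrary set of simplices so that it applies to every stage of a
  collapse: pairs of a vector field are disjoint, so deleting both members of one pair preserves
  it.\<close>

definition union_of_pairs :: "('a set \<times> 'a set) set \<Rightarrow> 'a set set \<Rightarrow> bool" where
  "union_of_pairs V S \<longleftrightarrow>
     (\<forall>\<sigma>\<in>S. \<exists>\<alpha> \<beta>. (\<alpha>, \<beta>) \<in> V \<and> \<alpha> \<in> S \<and> \<beta> \<in> S \<and> (\<sigma> = \<alpha> \<or> \<sigma> = \<beta>))"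

text \<open>All top-dimensional simplices of \<open>K - L\<close> are upper members of pairs. Among these pairs, one
  that no V-path enters has a lower simplex without any further coface.\<close>

lemma exists_free_pair:
  assumes V: "gradient_vector_field K0 V" and finV: "finite V"
    and K: "finite_simplicial_complex K" and L: "finite_simplicial_complex L" and sub: "L \<subset> K"
    and match: "union_of_pairs V (K - L)"
  obtains \<alpha> \<beta> where "(\<alpha>, \<beta>) \<in> V" "\<alpha> \<in> K - L" "\<beta> \<in> K - L"
    "\<And>\<tau>. \<tau> \<in> K \<Longrightarrow> \<alpha> \<subset> \<tau> \<Longrightarrow> \<tau> = \<beta>" "\<And>\<tau>. \<tau> \<in> K \<Longrightarrow> \<not> \<beta> \<subset> \<tau>"
proof -
  have fin: "finite x" if "x \<in> K" for x
    using complex_simplex[OF K that] ..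
  \<comment> \<open>The complement of a subcomplex is closed under cofaces in
    \<open>K\<close>.\<close>
  have up: "\<tau> \<in> K - L" if "\<tau> \<in> K" "\<sigma> \<in> K - L" "\<sigma> \<subseteq> \<tau>" for \<sigma> \<tau>
    using complex_face[OF L, of \<tau> \<sigma>] complex_simplex[OF K, of \<sigma>] that by auto
  note facetV = vector_field_facet(3)[OF V]
  define m where "m = Max (card ` (K - L))"
  have finKL: "finite (K - L)" using complex_finite[OF K] by simp
  have m_le: "card \<sigma> \<le> m" if "\<sigma> \<in> K - L" for \<sigma>
    using finKL that by (simp add: m_def)
  have "m \<in> card ` (K - L)" unfolding m_def using finKL sub by (intro Max_in) auto
  then obtain \<sigma>0 where \<sigma>0: "\<sigma>0 \<in> K - L" "card \<sigma>0 = m" by auto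
  define T where "T = {p \<in> V. fst p \<in> K - L \<and> snd p \<in> K - L \<and> card (snd p) = m}"
  have top: "\<exists>p\<in>T. snd p = \<sigma>" if \<sigma>: "\<sigma> \<in> K - L" "card \<sigma> = m" for \<sigma>
  proof -
    obtain \<alpha> \<beta> where p: "(\<alpha>, \<beta>) \<in> V" "\<alpha> \<in> K - L" "\<beta> \<in> K - L" "\<sigma> = \<alpha> \<or> \<sigma> = \<beta>"
      using match \<sigma>(1) unfolding union_of_pairs_def by blast
    have "card \<beta> = card \<alpha> + 1" using facetV[OF p(1)] by (simp add: facet_def)
    \<comment> \<open>A lower member of size \<open>m\<close> would have a partner of size
      \<open>m + 1\<close> in \<open>K - L\<close>, beyond the maximum.\<close>
    with m_le[OF p(3)] \<sigma>(2) p(4) have "\<sigma> = \<beta>" by auto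
    with p \<sigma>(2) show ?thesis by (intro bexI[of _ "(\<alpha>, \<beta>)"]) (auto simp: T_def)
  qed
  let ?R = "{(p, q). p \<in> V \<and> q \<in> V \<and> fst q \<noteq> fst p \<and> facet (fst q) (snd p)}"
  have "finite ?R" by (rule finite_subset[of _ "V \<times> V"]) (use finV in auto)
  then have wf: "wf ?R" using acyclic_pairs[OF V] by (rule finite_acyclic_wf)
  obtain p0 where "p0 \<in> T" using top[OF \<sigma>0] by blast
  \<comment> \<open>Minimality says that no pair \<open>q\<close> of \<open>T\<close> steps into
    \<open>p\<close>, that is, has \<open>fst p\<close> as a facet of \<open>snd q\<close> different
    from \<open>fst q\<close>.\<close>
  with wf obtain p where p: "p \<in> T" "\<And>q. (q, p) \<in> ?R \<Longrightarrow> q \<notin> T"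
    by (rule wfE_min) blast
  obtain \<alpha> \<beta> where ab: "p = (\<alpha>, \<beta>)" by (cases p)
  have *: "(\<alpha>, \<beta>) \<in> V" "\<alpha> \<in> K - L" "\<beta> \<in> K - L" "card \<beta> = m"
    using p(1) ab by (auto simp: T_def)
  have c\<beta>: "card \<beta> = card \<alpha> + 1" using facetV[OF *(1)] by (simp add: facet_def)
  show ?thesis
  proof (rule that[OF *(1-3)])
    fix \<tau> assume \<tau>: "\<tau> \<in> K" "\<alpha> \<subset> \<tau>"
    then have "\<tau> \<in> K - L" using up *(2) by blast
    moreover have "card \<alpha> < card \<tau>" using \<tau> fin by (intro psubset_card_mono) auto
    ultimately have m: "card \<tau> = m" using m_le[of \<tau>] c\<beta> *(4) by auto
    then obtain q where q: "q \<in> T" "snd q = \<tau>" using top \<open>\<tau> \<in> K - L\<close> by blast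
    have "facet \<alpha> \<tau>" using \<tau> m c\<beta> *(4) by (simp add: facet_def)
    moreover have "(q, p) \<notin> ?R" using p(2) q(1) by blast
    moreover have "p \<in> V" "q \<in> V" using p(1) q(1) by (simp_all add: T_def)
    \<comment> \<open>Otherwise \<open>q\<close> would step into \<open>p\<close>, against
      minimality.\<close>
    ultimately have "fst q = \<alpha>" using q(2) ab by auto
    moreover have "q \<in> V" using q(1) by (simp add: T_def)
    ultimately have "q = (\<alpha>, \<beta>)"
      using vector_field_unique[OF V _ _ *(1), of q \<alpha>] by simp
    then show "\<tau> = \<beta>" using q(2) by simp
  next
    fix \<tau> assume \<tau>: "\<tau> \<in> K"
    show "\<not> \<beta> \<subset> \<tau>"
    proof
      assume "\<beta> \<subset> \<tau>"
      moreover from this have "\<tau> \<in> K - L" using up[OF \<tau> *(3)] by blast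
      ultimately show False
        using m_le[of \<tau>] *(4) psubset_card_mono[OF fin[OF \<tau>], of \<beta>] by simp
    qed
  qed
qed

text \<open>Vanishing of the relative homology of \<open>K\<close> modulo \<open>L\<close>, by
  induction on the number of simplices outside \<open>L\<close>. For a free pair, subtracting a
  multiple of the boundary of \<open>\<beta>\<close> clears the coefficient at
  \<open>\<alpha>\<close>; the boundary condition at \<open>\<alpha>\<close> then clears the one at
  \<open>\<beta>\<close>, and the remaining chain lives in the smaller complex.\<close>

lemma relative_cycle_is_boundary:
  fixes c :: "'a set \<Rightarrow> 'k::field"
  assumes V: "gradient_vector_field K0 V" and finV: "finite V"
    and K: "finite_simplicial_complex K" and L: "finite_simplicial_complex L" and sub: "L \<subseteq> K"
    and match: "union_of_pairs V (K - L)"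
    and c: "c \<in> carrier (chain_space K i)" "\<forall>\<sigma>. \<sigma> \<notin> L \<longrightarrow> boundary K c \<sigma> = 0"
  shows "\<exists>d\<in>carrier (chain_space K (i + 1)). \<forall>\<sigma>. \<sigma> \<notin> L \<longrightarrow> c \<sigma> = boundary K d \<sigma>"
  using K sub match c
proof (induction "card (K - L)" arbitrary: K c rule: less_induct)
  case less
  note K = less.prems(1) and sub = less.prems(2) and match = less.prems(3)
  show ?case
  proof (cases "K = L")
    case True
    then show ?thesis using less.prems(4)
      by (intro bexI[of _ "\<lambda>\<sigma>. 0"]) (auto simp: chain_iff boundary_zero)
  next
    case False
    with sub have "L \<subset> K" by auto
    from exists_free_pair[OF V finV K L this match]
    obtain \<alpha> \<beta> where ab: "(\<alpha>, \<beta>) \<in> V" "\<alpha> \<in> K - L" "\<beta> \<in> K - L"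
      and free: "\<And>\<tau>. \<tau> \<in> K \<Longrightarrow> \<alpha> \<subset> \<tau> \<Longrightarrow> \<tau> = \<beta>" "\<And>\<tau>. \<tau> \<in> K \<Longrightarrow> \<not> \<beta> \<subset> \<tau>"
      by metis
    note f = vector_field_facet(3)[OF V ab(1)]
    then have neq: "\<alpha> \<noteq> \<beta>" "card \<beta> = card \<alpha> + 1" by (auto simp: facet_def)
    have finK: "finite K" and fin\<beta>: "finite \<beta>"
      using complex_finite[OF K] complex_simplex[OF K, of \<beta>] ab(3) by auto
    define e :: 'k where "e = incidence \<alpha> \<beta>"
    have e: "e \<noteq> 0" using f fin\<beta> by (simp add: e_def incidence_nonzero)
    define K' where "K' = K - {\<alpha>, \<beta>}"
    have K'L: "L \<subseteq> K'" using sub ab by (auto simp: K'_def)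
    have K'K: "K' \<subseteq> K" by (auto simp: K'_def)
    \<comment> \<open>The only proper coface of \<open>\<alpha>\<close> in \<open>K\<close> is
      \<open>\<beta>\<close>, which has none itself, so no remaining simplex has a removed
      face.\<close>
    have K': "finite_simplicial_complex K'"
      unfolding finite_simplicial_complex_def
    proof (intro conjI ballI allI impI)
      show "finite K'" using finK by (simp add: K'_def)
      fix \<sigma> assume \<sigma>: "\<sigma> \<in> K'"
      then show "finite \<sigma>" "\<sigma> \<noteq> {}" using complex_simplex[OF K, of \<sigma>] K'K by auto
      fix \<tau> assume \<tau>: "\<tau> \<subseteq> \<sigma> \<and> \<tau> \<noteq> {}"
      then have "\<tau> \<in> K" using complex_face[OF K, of \<sigma> \<tau>] \<sigma> K'K by auto
      moreover have "\<tau> \<noteq> \<alpha>" "\<tau> \<noteq> \<beta>"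
        using free \<sigma> \<tau> unfolding K'_def by blast+
      ultimately show "\<tau> \<in> K'" by (simp add: K'_def)
    qed
    have less': "card (K' - L) < card (K - L)"
      using finK ab by (intro psubset_card_mono) (auto simp: K'_def)
    have match': "union_of_pairs V (K' - L)"
      unfolding union_of_pairs_def
    proof
      fix \<sigma> assume \<sigma>: "\<sigma> \<in> K' - L"
      obtain \<alpha>' \<beta>' where q: "(\<alpha>', \<beta>') \<in> V" "\<alpha>' \<in> K - L" "\<beta>' \<in> K - L" "\<sigma> = \<alpha>' \<or> \<sigma> = \<beta>'"
        using bspec[OF match[unfolded union_of_pairs_def], of \<sigma>] \<sigma> K'K by auto
      have "(\<alpha>', \<beta>') \<noteq> (\<alpha>, \<beta>)" using \<sigma> q(4) by (auto simp: K'_def)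
      \<comment> \<open>Pairs sharing a simplex coincide, so the pair containing
        \<open>\<sigma>\<close> avoids both removed simplices.\<close>
      moreover have "(\<alpha>', \<beta>') = (\<alpha>, \<beta>)"
        if "\<rho> \<in> {\<alpha>', \<beta>'}" "\<rho> \<in> {\<alpha>, \<beta>}" for \<rho>
        using vector_field_unique[OF V q(1) _ ab(1), of \<rho>] that by simp
      ultimately have "\<alpha>' \<in> K' - L" "\<beta>' \<in> K' - L" using q by (auto simp: K'_def)
      then show "\<exists>\<alpha>' \<beta>'. (\<alpha>', \<beta>') \<in> V \<and> \<alpha>' \<in> K' - L \<and> \<beta>' \<in> K' - L \<and>
          (\<sigma> = \<alpha>' \<or> \<sigma> = \<beta>')"
        using q(1,4) by blast
    qed
    \<comment> \<open>The factor \<open>c \<alpha> / e\<close> gives the boundary of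
      \<open>d0\<close> the value \<open>c \<alpha>\<close> at \<open>\<alpha>\<close>. The degree
      fits because \<open>\<beta>\<close> has one vertex more than \<open>\<alpha>\<close>.\<close>
    define d0 :: "'a set \<Rightarrow> 'k" where "d0 = (\<lambda>\<sigma>. if \<sigma> = \<beta> then c \<alpha> / e else 0)"
    have d0: "d0 \<in> carrier (chain_space K (i + 1))"
      using less.prems(4) ab neq by (auto simp: d0_def chain_iff)
    have bd0: "boundary K d0 \<sigma> = (if \<sigma> \<in> K then incidence \<sigma> \<beta> * (c \<alpha> / e) else 0)" for \<sigma>
      using finK ab by (auto simp: boundary_def d0_def if_distrib cong: if_cong)
    define c' where "c' = (\<lambda>\<sigma>. c \<sigma> - boundary K d0 \<sigma>)"
    have c'ch: "c' \<in> carrier (chain_space K i)"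
      using chain_diff[OF less.prems(4)] boundary_chain[OF d0] by (simp add: c'_def)
    have bc': "boundary K c' = boundary K c"
      by (simp add: c'_def boundary_diff boundary_boundary[OF K])
    have c'\<alpha>: "c' \<alpha> = 0"
      using ab e by (simp add: c'_def bd0 flip: e_def)
    \<comment> \<open>By freeness \<open>\<beta>\<close> is the only simplex of \<open>K\<close>
      with facet \<open>\<alpha>\<close>, so the sum has a single term.\<close>
    have "boundary K c' \<alpha> = e * c' \<beta>"
    proof -
      have "boundary K c' \<alpha> = (\<Sum>\<tau>\<in>K. incidence \<alpha> \<tau> * c' \<tau>)"
        using ab by (simp add: boundary_def)
      also have "\<dots> = (\<Sum>\<tau>\<in>{\<beta>}. incidence \<alpha> \<tau> * c' \<tau>)"
        using finK ab free by (intro sum.mono_neutral_right) (auto simp: incidence_def facet_def)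
      finally show ?thesis by (simp add: e_def)
    qed
    moreover have "boundary K c' \<alpha> = 0" using bc' less.prems(5) ab by simp
    ultimately have c'\<beta>: "c' \<beta> = 0" using e by simp
    have c'K': "c' \<in> carrier (chain_space K' i)"
      using c'ch c'\<alpha> c'\<beta> unfolding chain_iff K'_def by auto
    have "\<forall>\<sigma>. \<sigma> \<notin> L \<longrightarrow> boundary K' c' \<sigma> = 0"
      using boundary_chain_mono[OF K' K K'K c'K'] bc' less.prems(5) by simp
    from less.hyps[OF less' K' K'L match' c'K' this]
    obtain d1 where d1: "d1 \<in> carrier (chain_space K' (i + 1))"
      "\<And>\<sigma>. \<sigma> \<notin> L \<Longrightarrow> c' \<sigma> = boundary K' d1 \<sigma>" by blast
    have d1K: "d1 \<in> carrier (chain_space K (i + 1))" using d1(1) chain_mono[OF K'K] by blast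
    have bd1: "boundary K d1 = boundary K' d1" using boundary_chain_mono[OF K' K K'K d1(1)] .
    show ?thesis
    proof (intro bexI allI impI)
      show "(\<lambda>\<sigma>. d0 \<sigma> + d1 \<sigma>) \<in> carrier (chain_space K (i + 1))"
        by (rule chain_add[OF d0 d1K])
      fix \<sigma> assume "\<sigma> \<notin> L"
      then show "c \<sigma> = boundary K (\<lambda>\<sigma>. d0 \<sigma> + d1 \<sigma>) \<sigma>"
        using d1(2)[of \<sigma>] by (simp add: boundary_add bd1 c'_def algebra_simps)
    qed
  qed
qed

section \<open>Dimensions of quotients of function spaces\<close>

text \<open>A linear map commutes with taking spans, and injectivity on the whole carrier allows
  cancelling it from an equality of images.\<close>

lemma (in linear_map) gen_set_image_iff:
  assumes inj: "inj_on T (carrier V)" and surj: "T ` carrier V = carrier W"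
    and A: "finite A" "A \<subseteq> carrier V"
  shows "W.module.span (T ` A) = carrier W \<longleftrightarrow> V.module.span A = carrier V"
proof -
  have "W.module.span (T ` A) = T ` V.module.span A"
  proof (intro equalityI subsetI)
    fix w assume "w \<in> W.module.span (T ` A)"
    then obtain a where a: "a \<in> T ` A \<rightarrow> carrier K" "w = W.module.lincomb a (T ` A)"
      using W.module.finite_span[of "T ` A"] A by (auto simp: subset_iff)
    then have "w = T (V.module.lincomb (a \<circ> T) A)"
      using lincomb_linear_image[OF inj A(2) a(1) A(1)] by simp
    moreover have "a \<circ> T \<in> A \<rightarrow> carrier K" using a(1) by auto
    then have "V.module.lincomb (a \<circ> T) A \<in> V.module.span A"
      using V.module.finite_span[OF A] by blast
    ultimately show "w \<in> T ` V.module.span A" by blast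
  next
    fix w assume "w \<in> T ` V.module.span A"
    then obtain b where b: "b \<in> A \<rightarrow> carrier K" "w = T (V.module.lincomb b A)"
      using V.module.finite_span[OF A] by auto
    \<comment> \<open>Moves the coefficients to the image points, each of which has exactly one
      preimage in \<open>A\<close>.\<close>
    define a where "a = b \<circ> inv_into A T"
    have injA: "inj_on T A" using inj A(2) by (rule inj_on_subset)
    have a: "a \<in> T ` A \<rightarrow> carrier K"
      using b(1) by (auto simp: a_def injA)
    have "V.module.lincomb (a \<circ> T) A = V.module.lincomb b A"
      unfolding V.module.lincomb_def
      by (rule V.module.M.finsum_cong') (use A b(1) injA in \<open>auto simp: a_def subset_iff Pi_iff\<close>)
    then have "w = W.module.lincomb a (T ` A)"
      using lincomb_linear_image[OF inj A(2) a A(1)] b(2) by simp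
    then show "w \<in> W.module.span (T ` A)"
      using W.module.finite_span[of "T ` A"] A a by (auto simp: subset_iff)
  qed
  moreover have "V.module.span A \<subseteq> carrier V" by (rule V.module.span_is_subset2[OF A(2)])
  ultimately show ?thesis
    using inj_on_image_eq_iff[OF inj, of "V.module.span A" "carrier V"] surj by simp
qed

text \<open>\<open>dim\<close> is the least size of a finite spanning set, and a linear bijection
  matches the spanning sets of each size, so both \<open>LEAST\<close> predicates coincide.\<close>

lemma (in linear_map) dim_bij:
  assumes inj: "inj_on T (carrier V)" and surj: "T ` carrier V = carrier W"
  shows "V.dim = W.dim"
proof -
  have "(\<exists>A. finite A \<and> card A = n \<and> A \<subseteq> carrier V \<and> V.module.span A = carrier V) \<longleftrightarrow>
      (\<exists>B. finite B \<and> card B = n \<and> B \<subseteq> carrier W \<and> W.module.span B = carrier W)" (is "?L \<longleftrightarrow> ?R") for n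
  proof
    assume ?L
    then obtain A where A: "finite A" "card A = n" "A \<subseteq> carrier V" "V.module.span A = carrier V" by blast
    have "card (T ` A) = n" using A inj by (metis card_image inj_on_subset)
    moreover have "W.module.span (T ` A) = carrier W" using gen_set_image_iff[OF inj surj A(1,3)] A(4) by blast
    moreover have "T ` A \<subseteq> carrier W" "finite (T ` A)" using A surj by auto
    ultimately show ?R by blast
  next
    assume ?R
    then obtain B where B: "finite B" "card B = n" "B \<subseteq> carrier W" "W.module.span B = carrier W" by blast
    define A where "A = inv_into (carrier V) T ` B"
    have TA: "T ` A = B" unfolding A_def using B(3) surj by (simp add: image_inv_into_cancel)
    have A: "finite A" "A \<subseteq> carrier V"
      unfolding A_def using B(1,3) inv_into_into[of _ T "carrier V"] by (auto simp: surj)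
    have "card A = n" using TA A(2) B(2) inj by (metis card_image inj_on_subset)
    moreover have "V.module.span A = carrier V" using gen_set_image_iff[OF inj surj A] B(4) TA by simp
    ultimately show ?L using A by blast
  qed
  then show ?thesis unfolding V.dim_def W.dim_def by simp
qed

section \<open>Cosets inside one ambient function space\<close>

definition function_subspace :: "('b \<Rightarrow> 'k::field) set \<Rightarrow> bool" where
  "function_subspace N \<longleftrightarrow> (\<lambda>s. 0) \<in> N \<and>
     (\<forall>x\<in>N. \<forall>y\<in>N. (\<lambda>s. x s + y s) \<in> N) \<and> (\<forall>a. \<forall>x\<in>N. (\<lambda>s. a * x s) \<in> N)"

text \<open>The coset of \<open>N\<close> through \<open>x\<close>. Chains of all complexes are
  functions of one type, so no complex has to be mentioned and cosets from different stages can be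
  compared as sets.\<close>

definition translate :: "('b \<Rightarrow> 'k::field) set \<Rightarrow> ('b \<Rightarrow> 'k) \<Rightarrow> ('b \<Rightarrow> 'k) set" where
  "translate N x = (\<lambda>n s. n s + x s) ` N"

text \<open>The undefined fields agree with those of the record \<open>quotient_space\<close>, so that the image
  of a map in homology is literally equal to such a record.\<close>

definition translates ::
    "('b \<Rightarrow> 'k::field) set \<Rightarrow> ('b \<Rightarrow> 'k) set \<Rightarrow> ('k, ('b \<Rightarrow> 'k) set) module" where
  "translates N Z =
     \<lparr>carrier = translate N ` Z, mult = undefined, one = undefined, zero = N,
      add = (\<lambda>X Y. \<Union>x\<in>X. \<Union>y\<in>Y. {\<lambda>s. x s + y s}),
      smult = (\<lambda>a X. \<Union>x\<in>X. translate N (\<lambda>s. a * x s))\<rparr>"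

context
  fixes N :: "('b \<Rightarrow> 'k::field) set"
  assumes N: "function_subspace N"
begin

lemma subspace_zero: "(\<lambda>s. 0) \<in> N"
  using N by (simp add: function_subspace_def)

lemma subspace_add: "x \<in> N \<Longrightarrow> y \<in> N \<Longrightarrow> (\<lambda>s. x s + y s) \<in> N"
  using N by (simp add: function_subspace_def)

lemma subspace_scale: "x \<in> N \<Longrightarrow> (\<lambda>s. a * x s) \<in> N"
  using N by (simp add: function_subspace_def)

lemma subspace_diff: "x \<in> N \<Longrightarrow> y \<in> N \<Longrightarrow> (\<lambda>s. x s - y s) \<in> N"
  using subspace_add[of x "\<lambda>s. (- 1) * y s"] subspace_scale[of y "- 1"] by simp

lemma mem_translate: "y \<in> translate N x \<longleftrightarrow> (\<lambda>s. y s - x s) \<in> N"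
proof
  assume "y \<in> translate N x"
  then show "(\<lambda>s. y s - x s) \<in> N" by (auto simp: translate_def)
next
  assume "(\<lambda>s. y s - x s) \<in> N"
  then show "y \<in> translate N x"
    unfolding translate_def by (rule image_eqI[rotated]) simp
qed

lemma translate_eq_iff: "translate N x = translate N y \<longleftrightarrow> (\<lambda>s. x s - y s) \<in> N"
proof
  assume "translate N x = translate N y"
  moreover have "x \<in> translate N x" using subspace_zero by (simp add: mem_translate)
  ultimately show "(\<lambda>s. x s - y s) \<in> N" by (simp add: mem_translate)
next
  assume d: "(\<lambda>s. x s - y s) \<in> N"
  show "translate N x = translate N y"
  proof (intro equalityI subsetI)
    fix z assume "z \<in> translate N x"
    then show "z \<in> translate N y"
      using subspace_add[OF _ d, of "\<lambda>s. z s - x s"] by (simp add: mem_translate)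
  next
    fix z assume "z \<in> translate N y"
    then show "z \<in> translate N x"
      using subspace_diff[OF _ d, of "\<lambda>s. z s - y s"] by (simp add: mem_translate)
  qed
qed

lemma translate_zero: "translate N (\<lambda>s. 0) = N"
  by (auto simp: translate_def)

lemma translates_carrier: "carrier (translates N Z) = translate N ` Z"
  by (simp add: translates_def)

lemma translates_zero: "\<zero>\<^bsub>translates N Z\<^esub> = translate N (\<lambda>s. 0)"
  by (simp add: translates_def translate_zero)

lemma translates_add:
  "translate N x \<oplus>\<^bsub>translates N Z\<^esub> translate N y = translate N (\<lambda>s. x s + y s)" (is "?l = ?r")
proof (intro equalityI subsetI)
  fix z assume "z \<in> ?l"
  then obtain x' y' where "x' \<in> translate N x" "y' \<in> translate N y" "z = (\<lambda>s. x' s + y' s)"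
    by (auto simp: translates_def)
  then show "z \<in> ?r"
    using subspace_add[of "\<lambda>s. x' s - x s" "\<lambda>s. y' s - y s"]
    by (simp add: mem_translate algebra_simps)
next
  fix z assume "z \<in> ?r"
  \<comment> \<open>\<open>z\<close> is split as \<open>(z - y) + y\<close>, one summand in each
    coset.\<close>
  then have "(\<lambda>s. z s - y s) \<in> translate N x" "y \<in> translate N y"
    using subspace_zero by (simp_all add: mem_translate algebra_simps)
  then show "z \<in> ?l"
    unfolding translates_def ring_record_simps by (intro UN_I) auto
qed

lemma translates_smult:
  "a \<odot>\<^bsub>translates N Z\<^esub> translate N x = translate N (\<lambda>s. a * x s)" (is "?l = ?r")
proof -
  have x: "x \<in> translate N x" using subspace_zero by (simp add: mem_translate)
  have eq: "translate N (\<lambda>s. a * x' s) = ?r" if "x' \<in> translate N x" for x'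
    using that subspace_scale[of "\<lambda>s. x' s - x s" a]
    by (simp add: mem_translate translate_eq_iff algebra_simps)
  have "?l = (\<Union>x'\<in>translate N x. translate N (\<lambda>s. a * x' s))" by (simp add: translates_def)
  also have "\<dots> = (\<Union>x'\<in>translate N x. ?r)" using eq by (intro SUP_cong) simp_all
  also have "\<dots> = ?r" using x by blast
  finally show ?thesis .
qed

end

lemma vectorspace_translates:
  fixes N Z :: "('b \<Rightarrow> 'k::field) set"
  assumes N: "function_subspace N" and Z: "function_subspace Z"
  shows "vectorspace class_ring (translates N Z)"
proof (rule vs_criteria)
  show "field (class_ring :: 'k ring)" by (rule class_field)
  note T = translates_carrier[OF N] translates_zero[OF N] translates_add[OF N]
    translates_smult[OF N]
  show "\<forall>v\<in>carrier (translates N Z).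
      \<exists>neg_v\<in>carrier (translates N Z). v \<oplus>\<^bsub>translates N Z\<^esub> neg_v = \<zero>\<^bsub>translates N Z\<^esub>"
  proof
    fix v assume "v \<in> carrier (translates N Z)"
    then obtain z where z: "z \<in> Z" "v = translate N z" by (auto simp: T)
    then show "\<exists>neg_v\<in>carrier (translates N Z). v \<oplus>\<^bsub>translates N Z\<^esub> neg_v = \<zero>\<^bsub>translates N Z\<^esub>"
      using subspace_scale[OF Z z(1), of "- 1"]
      by (intro bexI[of _ "translate N (\<lambda>s. (- 1) * z s)"]) (auto simp: T)
  qed
qed (use subspace_zero[OF Z] subspace_add[OF Z] subspace_scale[OF Z] in
    \<open>auto simp: translates_carrier[OF N] translates_zero[OF N] translates_add[OF N]
      translates_smult[OF N] algebra_simps\<close>)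

text \<open>The space is \<open>(Z + N) / N\<close>, isomorphic to
  \<open>Z / (Z \<inter> N)\<close>, so \<open>N\<close> enters only through its intersection with
  \<open>Z\<close>.\<close>

lemma dim_translates_cong:
  fixes N N' Z :: "('b \<Rightarrow> 'k::field) set"
  assumes N: "function_subspace N" and N': "function_subspace N'" and Z: "function_subspace Z"
    and eq: "\<And>z. z \<in> Z \<Longrightarrow> z \<in> N \<longleftrightarrow> z \<in> N'"
  shows "vectorspace.dim class_ring (translates N Z) = vectorspace.dim class_ring (translates N' Z)"
proof -
  have tr: "translate N x = translate N y \<longleftrightarrow> translate N' x = translate N' y"
    if "x \<in> Z" "y \<in> Z" for x y
    using eq[OF subspace_diff[OF Z that]] by (simp add: translate_eq_iff[OF N] translate_eq_iff[OF N'])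
  \<comment> \<open>The isomorphism picks a representative in \<open>Z\<close>; by \<open>tr\<close>
    its value does not depend on the choice.\<close>
  define f where "f = (\<lambda>X. translate N' (SOME z. z \<in> Z \<and> X = translate N z))"
  have f: "f (translate N z) = translate N' z" if "z \<in> Z" for z
  proof -
    have "(SOME y. y \<in> Z \<and> translate N z = translate N y) \<in> Z \<and>
        translate N z = translate N (SOME y. y \<in> Z \<and> translate N z = translate N y)"
      by (rule someI[of _ z]) (simp add: that)
    then show ?thesis using tr that unfolding f_def by metis
  qed
  interpret V: vectorspace class_ring "translates N Z" by (rule vectorspace_translates[OF N Z])
  interpret W: vectorspace class_ring "translates N' Z" by (rule vectorspace_translates[OF N' Z])
  have "f \<in> module_hom class_ring (translates N Z) (translates N' Z)"
    unfolding module_hom_def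
    using subspace_add[OF Z] subspace_scale[OF Z]
    by (auto simp: f translates_carrier[OF N] translates_carrier[OF N'] translates_add[OF N]
        translates_add[OF N'] translates_smult[OF N] translates_smult[OF N'])
  then interpret linear_map class_ring "translates N Z" "translates N' Z" f
    by unfold_locales
  show ?thesis
  proof (rule dim_bij)
    show "inj_on f (carrier (translates N Z))"
      using tr by (auto simp: inj_on_def f translates_carrier[OF N])
    show "f ` carrier (translates N Z) = carrier (translates N' Z)"
      by (auto simp: f translates_carrier[OF N] translates_carrier[OF N'] image_image)
  qed
qed

text \<open>All cosets collapse to \<open>N\<close>, the zero vector, so the empty set already
  spans.\<close>

lemma dim_translates_zero:
  fixes N Z :: "('b \<Rightarrow> 'k::field) set"
  assumes N: "function_subspace N" and Z: "function_subspace Z" and sub: "Z \<subseteq> N"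
  shows "vectorspace.dim class_ring (translates N Z) = 0"
proof -
  interpret V: vectorspace class_ring "translates N Z" by (rule vectorspace_translates[OF N Z])
  have "translate N z = N" if "z \<in> Z" for z
    using that sub translate_eq_iff[OF N, of z "\<lambda>s. 0"] by (auto simp: translate_zero[OF N])
  then have "translate N ` Z = (\<lambda>_. N) ` Z" by (rule image_cong[OF refl])
  then have "carrier (translates N Z) = {\<zero>\<^bsub>translates N Z\<^esub>}"
    using subspace_zero[OF Z] by (auto simp: translates_carrier[OF N] translates_def)
  then have "V.gen_set {}" by (simp add: V.span_empty)
  then show ?thesis unfolding V.dim_def by (intro Least_eq_0 exI[of _ "{}"]) simp
qed

section \<open>Ranks of maps in homology\<close>

lemma function_subspace_cycles:
  "function_subspace (carrier (cycle_space K i :: ('k::field, 'a set \<Rightarrow> 'k) module))"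
  by (simp add: function_subspace_def cycle_iff chain_zero chain_add chain_scale boundary_zero
      boundary_add boundary_scale)

lemma function_subspace_boundaries:
  "function_subspace (boundaries K i :: ('a set \<Rightarrow> 'k::field) set)"
  unfolding function_subspace_def
proof (intro conjI ballI allI)
  show "(\<lambda>s. 0) \<in> (boundaries K i :: ('a set \<Rightarrow> 'k) set)"
    unfolding boundaries_def
    by (rule image_eqI[OF _ chain_zero]) (simp add: boundary_zero)
next
  fix x y :: "'a set \<Rightarrow> 'k" assume "x \<in> boundaries K i" "y \<in> boundaries K i"
  then obtain c d where "c \<in> carrier (chain_space K (i + 1))" "x = boundary K c"
    "d \<in> carrier (chain_space K (i + 1))" "y = boundary K d" by (auto simp: boundaries_def)
  then show "(\<lambda>s. x s + y s) \<in> boundaries K i"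
    unfolding boundaries_def
    by (intro image_eqI[of _ _ "\<lambda>\<sigma>. c \<sigma> + d \<sigma>"]) (simp_all add: boundary_add chain_add)
next
  fix a and x :: "'a set \<Rightarrow> 'k" assume "x \<in> boundaries K i"
  then obtain c where "c \<in> carrier (chain_space K (i + 1))" "x = boundary K c"
    by (auto simp: boundaries_def)
  then show "(\<lambda>s. a * x s) \<in> boundaries K i"
    unfolding boundaries_def
    by (intro image_eqI[of _ _ "\<lambda>\<sigma>. a * c \<sigma>"]) (simp_all add: boundary_scale chain_scale)
qed

lemma coset_eq_translate: "N +>\<^bsub>cycle_space K i\<^esub> z = translate N z"
  by (auto simp: a_r_coset_def r_coset_def cycle_space_def chain_space_def translate_def)

lemma homology_carrier:
  "carrier (homology K i) = translate (boundaries K i) ` carrier (cycle_space K i)"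
  by (auto simp: homology_def quotient_space_def A_RCOSETS_def RCOSETS_def
      coset_eq_translate[unfolded a_r_coset_def])

text \<open>The union in \<open>homology_map\<close> runs over all representatives; they differ by
  boundaries of \<open>K\<close>, which are boundaries of \<open>L\<close>, so all yield the same
  coset.\<close>

lemma homology_map_translate:
  assumes "finite_simplicial_complex K" "finite_simplicial_complex L" "K \<subseteq> L"
  shows "homology_map K L i (translate (boundaries K i) z) = translate (boundaries L i) z"
proof -
  have eq: "translate (boundaries L i) x = translate (boundaries L i) z"
    if "x \<in> translate (boundaries K i) z" for x
    using that boundaries_mono[OF assms]
    by (auto simp: mem_translate[OF function_subspace_boundaries]
        translate_eq_iff[OF function_subspace_boundaries])
  have z: "z \<in> translate (boundaries K i) z"
    by (simp add: mem_translate[OF function_subspace_boundaries]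
        subspace_zero[OF function_subspace_boundaries])
  have "homology_map K L i (translate (boundaries K i) z) =
      (\<Union>x\<in>translate (boundaries K i) z. translate (boundaries L i) x)"
    by (simp add: homology_map_def coset_eq_translate)
  also have "\<dots> = (\<Union>x\<in>translate (boundaries K i) z. translate (boundaries L i) z)"
    using eq by (intro SUP_cong) simp_all
  also have "\<dots> = translate (boundaries L i) z" using z by blast
  finally show ?thesis .
qed

text \<open>The image consists of the classes in \<open>L\<close> of the cycles of \<open>K\<close>.
  This separates the two arguments of the rank: the source enters only through its cycles, the
  target only through its boundaries.\<close>

lemma map_rank_homology_map:
  assumes "finite_simplicial_complex K" "finite_simplicial_complex L" "K \<subseteq> L"
  shows "map_rank (homology K i :: ('k::field, ('a set \<Rightarrow> 'k) set) module) (homology L i)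
      (homology_map K L i) =
    vectorspace.dim class_ring
      (translates (boundaries L i) (carrier (cycle_space K i)) :: ('k, ('a set \<Rightarrow> 'k) set) module)"
proof -
  have "homology_map K L i ` carrier (homology K i :: ('k, ('a set \<Rightarrow> 'k) set) module) =
      translate (boundaries L i) ` carrier (cycle_space K i)"
    by (simp add: homology_carrier image_image homology_map_translate[OF assms])
  \<comment> \<open>The operations of a cycle space do not depend on the complex, so the image
    record agrees with \<open>translates\<close> field by field.\<close>
  moreover have "set_add (cycle_space L i :: ('k, 'a set \<Rightarrow> 'k) module) =
      (\<lambda>X Y. \<Union>x\<in>X. \<Union>y\<in>Y. {\<lambda>s. x s + y s})"
    by (intro ext) (simp add: set_add_defs cycle_space_def chain_space_def)
  moreover have "smult (cycle_space L i :: ('k, 'a set \<Rightarrow> 'k) module) = (\<lambda>a c \<sigma>. a * c \<sigma>)"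
    by (simp add: cycle_space_def chain_space_def)
  ultimately have "(homology L i)
      \<lparr>carrier := homology_map K L i ` carrier (homology K i :: ('k, ('a set \<Rightarrow> 'k) set) module)\<rparr> =
      translates (boundaries L i) (carrier (cycle_space K i))"
    by (simp add: homology_def quotient_space_def translates_def coset_eq_translate)
  then show ?thesis by (simp add: map_rank_def)
qed

section \<open>Homological consequences of a collapse\<close>

text \<open>Surjectivity of the inclusion on homology: a cycle is in particular a relative cycle, so
  off \<open>L\<close> it agrees with a boundary, and subtracting that boundary leaves a cycle of
  \<open>L\<close>.\<close>

lemma cycle_homologous:
  assumes V: "gradient_vector_field K0 V" "finite V"
    and K: "finite_simplicial_complex K" and L: "finite_simplicial_complex L" and sub: "L \<subseteq> K"
    and match: "union_of_pairs V (K - L)"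
    and z: "z \<in> carrier (cycle_space K i)"
  shows "\<exists>z'\<in>carrier (cycle_space L i). (\<lambda>\<sigma>. z \<sigma> - z' \<sigma>) \<in> boundaries K i"
proof -
  have z': "z \<in> carrier (chain_space K i)" "boundary K z = (\<lambda>\<sigma>. 0)"
    using z by (simp_all add: cycle_iff)
  then obtain d where d: "d \<in> carrier (chain_space K (i + 1))"
    "\<forall>\<sigma>. \<sigma> \<notin> L \<longrightarrow> z \<sigma> = boundary K d \<sigma>"
    using relative_cycle_is_boundary[OF V K L sub match z'(1)] by auto
  define y where "y = (\<lambda>\<sigma>. z \<sigma> - boundary K d \<sigma>)"
  have "y \<in> carrier (chain_space K i)"
    using chain_diff[OF z'(1)] boundary_chain[OF d(1)] by (simp add: y_def)
  then have y: "y \<in> carrier (chain_space L i)"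
    using d(2) by (auto simp: chain_iff y_def)
  have "boundary L y = boundary K y" using boundary_chain_mono[OF L K sub y] by simp
  also have "\<dots> = (\<lambda>\<sigma>. 0)"
    by (simp add: y_def boundary_diff boundary_boundary[OF K] z'(2))
  finally have "y \<in> carrier (cycle_space L i)" using y by (simp add: cycle_iff)
  moreover have "(\<lambda>\<sigma>. z \<sigma> - y \<sigma>) = boundary K d" by (simp add: y_def)
  ultimately show ?thesis using d(1) by (auto simp: boundaries_def)
qed

text \<open>Injectivity on homology: a chain \<open>c\<close> of \<open>K\<close> bounding
  \<open>z\<close> is a relative cycle. Subtracting the boundary that agrees with it off
  \<open>L\<close> moves it into \<open>L\<close> without changing its own boundary
  \<open>z\<close>.\<close>

lemma boundary_reflected:
  assumes V: "gradient_vector_field K0 V" "finite V"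
    and K: "finite_simplicial_complex K" and L: "finite_simplicial_complex L" and sub: "L \<subseteq> K"
    and match: "union_of_pairs V (K - L)"
    and z: "z \<in> carrier (cycle_space L i)" "z \<in> boundaries K i"
  shows "z \<in> boundaries L i"
proof -
  obtain c where c: "c \<in> carrier (chain_space K (i + 1))" "z = boundary K c"
    using z(2) by (auto simp: boundaries_def)
  have "\<forall>\<sigma>. \<sigma> \<notin> L \<longrightarrow> boundary K c \<sigma> = 0"
    using z(1) c(2) by (auto simp: cycle_iff chain_iff)
  from relative_cycle_is_boundary[OF V K L sub match c(1) this]
  obtain d where d: "d \<in> carrier (chain_space K (i + 1 + 1))"
    "\<forall>\<sigma>. \<sigma> \<notin> L \<longrightarrow> c \<sigma> = boundary K d \<sigma>" by auto
  define y where "y = (\<lambda>\<sigma>. c \<sigma> - boundary K d \<sigma>)"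
  have "y \<in> carrier (chain_space K (i + 1))"
    using chain_diff[OF c(1), of "boundary K d"] boundary_chain[OF d(1)]
    by (simp add: y_def add.commute)
  then have y: "y \<in> carrier (chain_space L (i + 1))"
    using d(2) by (auto simp: chain_iff y_def)
  have "boundary L y = boundary K y" using boundary_chain_mono[OF L K sub y] by simp
  also have "\<dots> = z"
    by (simp add: y_def boundary_diff boundary_boundary[OF K] c(2))
  finally show ?thesis using y by (auto simp: boundaries_def)
qed

section \<open>Consistency, critical simplices and entrance values\<close>

text \<open>The two forms of \<open>L\<close> serve the two cases of the theorem. In both,
  consistency puts the members of a pair on the same side of \<open>L\<close>.\<close>

lemma union_of_pairs_noncritical:
  assumes V: "consistent V F" and K: "F w \<subseteq> K"
    and L: "L = {} \<or> (\<exists>x. L = F x)"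
    and crit: "\<And>\<sigma>. \<sigma> \<in> critical_simplices K V \<Longrightarrow> \<sigma> \<in> F w \<Longrightarrow> \<sigma> \<in> L"
  shows "union_of_pairs V (F w - L)"
  unfolding union_of_pairs_def
proof
  fix \<sigma> assume \<sigma>: "\<sigma> \<in> F w - L"
  then have "\<sigma> \<notin> critical_simplices K V" using crit by blast
  then obtain \<alpha> \<beta> where ab: "(\<alpha>, \<beta>) \<in> V" "\<sigma> = \<alpha> \<or> \<sigma> = \<beta>"
    using \<sigma> K by (auto simp: critical_simplices_def)
  have "\<alpha> \<in> F x \<longleftrightarrow> \<beta> \<in> F x" for x using V ab(1) by (auto simp: consistent_def)
  then have "\<alpha> \<in> F w - L" "\<beta> \<in> F w - L" using \<sigma> ab(2) L by auto
  then show "\<exists>\<alpha> \<beta>. (\<alpha>, \<beta>) \<in> V \<and> \<alpha> \<in> F w - L \<and> \<beta> \<in> F w - L \<and> (\<sigma> = \<alpha> \<or> \<sigma> = \<beta>)"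
    using ab by blast
qed

lemma entrance_value_iff:
  assumes "tame_one_critical K F" "\<sigma> \<in> K"
  shows "\<sigma> \<in> F v \<longleftrightarrow> entrance_value F \<sigma> \<le> v"
proof -
  have "is_entrance_value F \<sigma> (entrance_value F \<sigma>)"
    unfolding entrance_value_def by (rule theI') (use assms in \<open>auto simp: tame_one_critical_def\<close>)
  then show ?thesis by (simp add: is_entrance_value_def)
qed

lemma subset_lub_closure: "C \<subseteq> lub_closure C"
proof
  fix c assume "c \<in> C"
  then have "finite {c}" "{c} \<noteq> {}" "{c} \<subseteq> C" "c = \<Squnion>\<^sub>f\<^sub>i\<^sub>n{c}" by auto
  then show "c \<in> lub_closure C" unfolding lub_closure_def by blast
qed

theorem theorem2p4:
  fixes K :: "'a set set"
    and F :: "real ^ 'n::finite \<Rightarrow> 'a set set"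
    and V :: "('a set \<times> 'a set) set"
    and i :: int
    and u v :: "real ^ 'n"
  assumes "finite_simplicial_complex K"
    and "filtration K F"
    and "tame_one_critical K F"
    and "gradient_vector_field K V"
    and "consistent V F"
    and "u \<le> v"
  defines "C \<equiv> entrance_value F ` critical_simplices K V"
  shows "({u' \<in> lub_closure C. u' \<le> u} \<noteq> {} \<longrightarrow>
            rank_invariant TYPE('k::field) F i u v =
            rank_invariant TYPE('k) F i (max_below (lub_closure C) u) (max_below (lub_closure C) v)) \<and>
         ({u' \<in> lub_closure C. u' \<le> u} = {} \<longrightarrow> rank_invariant TYPE('k) F i u v = 0)"
proof -
  note V = assms(4)
  have cx: "finite_simplicial_complex (F w)" and FK: "F w \<subseteq> K" for w
    using assms(2) by (auto simp: filtration_def subcomplex_def)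
  have mono: "F w \<subseteq> F w'" if "w \<le> w'" for w w'
    using assms(2) that by (simp add: filtration_def)
  have finK: "finite K" by (rule complex_finite[OF assms(1)])
  have finV: "finite V"
    using vector_field_facet(1,2)[OF V] finK by (intro finite_subset[of V "K \<times> K"]) auto
  have finC: "finite C" unfolding C_def critical_simplices_def using finK by simp
  let ?Z = "\<lambda>w. carrier (cycle_space (F w) i :: ('k, 'a set \<Rightarrow> 'k) module)"
  let ?B = "\<lambda>w. boundaries (F w) i :: ('a set \<Rightarrow> 'k) set"
  let ?m = "max_below (lub_closure C)"
  have rank: "rank_invariant TYPE('k) F i w w' =
      vectorspace.dim class_ring (translates (?B w') (?Z w))" if "w \<le> w'" for w w'
    unfolding rank_invariant_def by (rule map_rank_homology_map[OF cx cx mono[OF that]])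
  \<comment> \<open>A critical simplex of \<open>F w\<close> witnesses by its own entrance value
    that the closure has an element below \<open>w\<close>.\<close>
  have crit: "entrance_value F \<sigma> \<in> lub_closure C" "entrance_value F \<sigma> \<le> w"
    if "\<sigma> \<in> critical_simplices K V" "\<sigma> \<in> F w" for \<sigma> w
    using that subset_lub_closure[of C] entrance_value_iff[OF assms(3), of \<sigma> w] FK[of w]
    by (auto simp: C_def)
  show ?thesis
  proof (intro conjI impI)
    assume ne: "{u' \<in> lub_closure C. u' \<le> u} \<noteq> {}"
    then have ne': "{u' \<in> lub_closure C. u' \<le> v} \<noteq> {}" using assms(6) by force
    note mu = max_below_lub_closure[OF finC ne] and mv = max_below_lub_closure[OF finC ne']
    have le: "?m u \<le> ?m v" using mu(1,2) mv(3) assms(6) by (meson order_trans)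
    have match: "union_of_pairs V (F w - F (?m w))"
      if "{u' \<in> lub_closure C. u' \<le> w} \<noteq> {}" for w
    proof (rule union_of_pairs_noncritical[OF assms(5) FK])
      fix \<sigma> assume \<sigma>: "\<sigma> \<in> critical_simplices K V" "\<sigma> \<in> F w"
      have "entrance_value F \<sigma> \<le> ?m w"
        by (rule max_below_lub_closure(3)[OF finC that crit[OF \<sigma>]])
      then show "\<sigma> \<in> F (?m w)"
        using entrance_value_iff[OF assms(3)] \<sigma>(2) FK by blast
    qed blast
    note BN = function_subspace_boundaries
    \<comment> \<open>Replacing the source stage changes nothing: each cycle at \<open>u\<close> is
      homologous in \<open>F u\<close>, hence in \<open>F v\<close>, to a cycle at
      \<open>?m u\<close>.\<close>
    have "translate (?B v) ` ?Z u = translate (?B v) ` ?Z (?m u)"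
    proof (intro equalityI subsetI)
      fix X assume "X \<in> translate (?B v) ` ?Z u"
      then obtain z where z: "z \<in> ?Z u" "X = translate (?B v) z" by blast
      obtain z' where z': "z' \<in> ?Z (?m u)" "(\<lambda>\<sigma>. z \<sigma> - z' \<sigma>) \<in> ?B u"
        using cycle_homologous[OF V finV cx cx mono[OF mu(2)] match[OF ne] z(1)] by blast
      then have "X = translate (?B v) z'"
        using boundaries_mono[OF cx cx mono[OF assms(6)]] z(2) translate_eq_iff[OF BN] by blast
      then show "X \<in> translate (?B v) ` ?Z (?m u)" using z'(1) by blast
    qed (use cycle_mono[OF cx cx mono[OF mu(2)]] in blast)
    then have "translates (?B v) (?Z u) = translates (?B v) (?Z (?m u))"
      by (simp add: translates_def)
    \<comment> \<open>Replacing the target stage: the cycles at \<open>?m u\<close> are also cycles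
      at \<open>?m v\<close>, and for those bounding in \<open>F v\<close> and bounding in
      \<open>F (?m v)\<close> are equivalent.\<close>
    moreover have "vectorspace.dim class_ring (translates (?B v) (?Z (?m u))) =
        vectorspace.dim class_ring (translates (?B (?m v)) (?Z (?m u)))"
    proof (rule dim_translates_cong[OF BN BN function_subspace_cycles])
      fix z assume "z \<in> ?Z (?m u)"
      then have "z \<in> ?Z (?m v)" using cycle_mono[OF cx cx mono[OF le]] by blast
      then show "z \<in> ?B v \<longleftrightarrow> z \<in> ?B (?m v)"
        using boundary_reflected[OF V finV cx cx mono[OF mv(2)] match[OF ne']]
          boundaries_mono[OF cx cx mono[OF mv(2)]] by blast
    qed
    ultimately show "rank_invariant TYPE('k) F i u v = rank_invariant TYPE('k) F i (?m u) (?m v)"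
      by (simp add: rank[OF assms(6)] rank[OF le])
  next
    assume e: "{u' \<in> lub_closure C. u' \<le> u} = {}"
    \<comment> \<open>A critical simplex in \<open>F u\<close> would put its entrance value into the
      set that \<open>e\<close> says is empty.\<close>
    have match: "union_of_pairs V (F u - {})"
      by (rule union_of_pairs_noncritical[OF assms(5) FK]) (use crit e in blast)+
    have empty: "finite_simplicial_complex ({} :: 'a set set)"
      by (simp add: finite_simplicial_complex_def)
    \<comment> \<open>The only cycle of the empty complex is zero, so every cycle at
      \<open>u\<close> bounds in \<open>F u\<close> and therefore in \<open>F v\<close>.\<close>
    have "?Z u \<subseteq> ?B v"
    proof
      fix z assume "z \<in> ?Z u"
      from cycle_homologous[OF V finV cx empty empty_subsetI match this]
      obtain z' where "z' \<in> carrier (cycle_space {} i)" "(\<lambda>\<sigma>. z \<sigma> - z' \<sigma>) \<in> ?B u" by blast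
      moreover from this(1) have "z' = (\<lambda>\<sigma>. 0)" by (auto simp: cycle_iff chain_iff)
      ultimately show "z \<in> ?B v" using boundaries_mono[OF cx cx mono[OF assms(6)]] by auto
    qed
    then show "rank_invariant TYPE('k) F i u v = 0"
      by (simp add: rank[OF assms(6)] dim_translates_zero[OF function_subspace_boundaries
            function_subspace_cycles])
  qed
qed

end
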